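(* Let $P=(\mathcal{N},\preceq)$ be a finite poset, $(P,\mathcal{F})$ a poset matroid, and $f:\mathcal{D}(P)\to\mathbb{R}_+$ a monotone DR-submodular function. Then the Poset Greedy algorithm (described in the context) is a $\frac12$-approximation for $\max\{f(S):S\in\mathcal{F}\}$, i.e. it returns a set $S\in\mathcal{F}$ with $f(S)\ge\frac12\max_{T\in\mathcal{F}}f(T)$. Moreover, in the case of a cardinality constraint, i.e. $\mathcal{F}=\{S\in\mathcal{D}(P):|S|\le k\}$ for some $k\in\mathbb{N}$, it is a $(1-\frac1e)$-approximation, i.e. $f(S)\ge(1-\frac1e)\max_{T\in\mathcal{F}}f(T)$.
   Context: For a finite poset $P=(\mathcal{N},\preceq)$, an ideal is a set $S\subseteq\mathcal{N}$ such that $s\in S$ and $t\preceq s$ imply $t\in S$; $\mathcal{D}(P)$ is the set of all ideals of $P$ (a distributive lattice under union and intersection). Write $S+x=S\cup\{x\}$. A function $f:\mathcal{D}(P)\to\mathbb{R}_+$ is DR-submodular if $f(S+x)-f(S)\ge f(T+y)-f(T)$ for all $S,T\in\mathcal{D}(P)$ with $S\subseteq T$ and all $x\preceq y$ with $x\notin S$, $y\notin T$, $S+x\in\mathcal{D}(P)$ and $T+y\in\mathcal{D}(P)$. It is monotone if $f(S)\le f(T)$ whenever $S\subseteq T$. A poset matroid $(P,\mathcal{F})$ consists of a poset $P=(\mathcal{N},\preceq)$ and a nonempty family $\mathcal{F}\subseteq\mathcal{D}(P)$ (the independent sets) such that (M1) if $Y\in\mathcal{F}$, $X\subset Y$ and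 $X\in\mathcal{D}(P)$, then $X\in\mathcal{F}$; (M2) if $X,Y\in\mathcal{F}$ and $|X|<|Y|$, then there is $e\in Y\setminus X$ with $X\cup\{e\}\in\mathcal{F}$. Poset Greedy algorithm. Start with $S=\emptyset$ and all elements unprocessed. As long as there is an unprocessed element $x\in\mathcal{N}$ with $S+x\in\mathcal{D}(P)$: among all such elements, select one, $x_t$, maximizing $f(S+x)-f(S)$, mark it as processed, and if $S+x_t\in\mathcal{F}$, replace $S$ by $S+x_t$ (otherwise $x_t$ is discarded). Finally return $S$. *)

theory Defs
  imports Complex_Main
begin

text \<open>
  A poset is given by a carrier \<open>N\<close> and a relation \<open>r\<close> with \<open>partial_order_on N r\<close>, where
  \<open>(t, s) \<in> r\<close> means that \<open>t\<close> is below or equal to \<open>s\<close>. Set functions are total on \<open>'a set\<close>,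
  but only their values on ideals are ever used.
\<close>

definition ideals :: "'a set \<Rightarrow> 'a rel \<Rightarrow> 'a set set" where
  "ideals N r = {S. S \<subseteq> N \<and> (\<forall>s\<in>S. \<forall>t\<in>N. (t, s) \<in> r \<longrightarrow> t \<in> S)}"

definition dr_submodular :: "'a set \<Rightarrow> 'a rel \<Rightarrow> ('a set \<Rightarrow> real) \<Rightarrow> bool" where
  "dr_submodular N r f \<longleftrightarrow>
    (\<forall>S\<in>ideals N r. \<forall>T\<in>ideals N r. \<forall>x y.
       S \<subseteq> T \<and> (x, y) \<in> r \<and> x \<notin> S \<and> y \<notin> T \<and>
       insert x S \<in> ideals N r \<and> insert y T \<in> ideals N r \<longrightarrow>
       f (insert x S) - f S \<ge> f (insert y T) - f T)"

definition poset_matroid :: "'a set \<Rightarrow> 'a rel \<Rightarrow> 'a set set \<Rightarrow> bool" where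
  "poset_matroid N r F \<longleftrightarrow>
    finite N \<and> partial_order_on N r \<and> F \<noteq> {} \<and> F \<subseteq> ideals N r \<and>
    (\<forall>Y\<in>F. \<forall>X\<in>ideals N r. X \<subset> Y \<longrightarrow> X \<in> F) \<and>
    (\<forall>X\<in>F. \<forall>Y\<in>F. card X < card Y \<longrightarrow> (\<exists>e\<in>Y - X. insert e X \<in> F))"

text \<open>
  A state of the greedy algorithm is a pair \<open>(S, Q)\<close> of the current solution \<open>S\<close> and the set \<open>Q\<close>
  of processed elements. Ties between maximizers are broken arbitrarily, so the algorithm is a
  nondeterministic transition relation that may have several possible outputs.
\<close>

definition greedy_candidates :: "'a set \<Rightarrow> 'a rel \<Rightarrow> 'a set \<Rightarrow> 'a set \<Rightarrow> 'a set" where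
  "greedy_candidates N r S Q = {x \<in> N - Q. insert x S \<in> ideals N r}"

inductive greedy_step ::
  "'a set \<Rightarrow> 'a rel \<Rightarrow> 'a set set \<Rightarrow> ('a set \<Rightarrow> real) \<Rightarrow> 'a set \<times> 'a set \<Rightarrow> 'a set \<times> 'a set \<Rightarrow> bool"
  for N :: "'a set" and r :: "'a rel" and F :: "'a set set" and f :: "'a set \<Rightarrow> real"
where
  "is_arg_max (\<lambda>x. f (insert x S) - f S) (\<lambda>x. x \<in> greedy_candidates N r S Q) x \<Longrightarrow>
   greedy_step N r F f (S, Q) (if insert x S \<in> F then insert x S else S, insert x Q)"

definition greedy_returns ::
  "'a set \<Rightarrow> 'a rel \<Rightarrow> 'a set set \<Rightarrow> ('a set \<Rightarrow> real) \<Rightarrow> 'a set \<Rightarrow> bool" where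
  "greedy_returns N r F f S \<longleftrightarrow>
    (\<exists>Q. (greedy_step N r F f)\<^sup>*\<^sup>* ({}, {}) (S, Q) \<and> greedy_candidates N r S Q = {})"

end

theory Submission
  imports Defs
begin

text \<open>
  Let \<open>S\<^sub>i\<close> be the greedy solution of size \<open>i\<close> and \<open>g\<^sub>i\<close> the gain of its last element.
  Feasible elements are never discarded, so \<open>g\<^sub>i\<close> bounds the gain over \<open>S\<^sub>i\<^sub>-\<^sub>1\<close> of every feasible
  element, and DR-submodularity makes \<open>g\<close> nonincreasing. For an independent \<open>T\<close>, call \<open>t \<in> T\<close>
  blocked by \<open>S\<close> if no \<open>e \<preceq> t\<close> outside \<open>S\<close> can be added to \<open>S\<close>. The blocked elements \<open>B\<^sub>i\<close> of
  \<open>S\<^sub>i\<close> form an independent ideal that cannot be used to augment \<open>S\<^sub>i\<close>, hence \<open>|B\<^sub>i| \<le> i\<close>. An element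
  that becomes blocked at step \<open>i\<close> is above an element that was feasible for \<open>S\<^sub>i\<^sub>-\<^sub>1\<close>, so by
  DR-submodularity it contributes at most \<open>g\<^sub>i\<close> on top of any larger ideal. Summation by parts
  bounds \<open>f (S \<union> T) - f S\<close> by the sum of all gains, which is at most \<open>f S\<close>.
  For a cardinality constraint nothing is blocked before the end, and each step closes a
  fraction \<open>1/k\<close> of the gap to the optimum.
\<close>

section \<open>Ideals, independence and marginal gains\<close>

locale dr_poset_matroid =
  fixes N :: "'a set" and r :: "'a rel" and F :: "'a set set" and f :: "'a set \<Rightarrow> real"
  assumes matroid: "poset_matroid N r F"
    and nonneg: "S \<in> ideals N r \<Longrightarrow> 0 \<le> f S"
    and mono: "mono_on (ideals N r) f"
    and dr: "dr_submodular N r f"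
begin

lemma finite_carrier: "finite N"
  and refl_r: "x \<in> N \<Longrightarrow> (x, x) \<in> r"
  and trans_r: "(x, y) \<in> r \<Longrightarrow> (y, z) \<in> r \<Longrightarrow> (x, z) \<in> r"
  and antisym_r: "(x, y) \<in> r \<Longrightarrow> (y, x) \<in> r \<Longrightarrow> x = y"
  using matroid
  unfolding poset_matroid_def partial_order_on_def preorder_on_def refl_on_def antisym_def
  by (auto dest: transD)

lemma indep_ideal: "S \<in> F \<Longrightarrow> S \<in> ideals N r"
  using matroid by (auto simp: poset_matroid_def)

lemma indep_subset: "Y \<in> F \<Longrightarrow> X \<in> ideals N r \<Longrightarrow> X \<subseteq> Y \<Longrightarrow> X \<in> F"
  using matroid unfolding poset_matroid_def by (metis psubsetI)

lemma indep_augment: "X \<in> F \<Longrightarrow> Y \<in> F \<Longrightarrow> card X < card Y \<Longrightarrow> \<exists>e\<in>Y - X. insert e X \<in> F"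
  using matroid by (auto simp: poset_matroid_def)

lemma ideal_subset: "S \<in> ideals N r \<Longrightarrow> S \<subseteq> N"
  by (simp add: ideals_def)

lemma ideal_finite: "S \<in> ideals N r \<Longrightarrow> finite S"
  using finite_carrier ideal_subset finite_subset by blast

lemma ideal_empty: "{} \<in> ideals N r"
  by (simp add: ideals_def)

lemma ideal_Un: "S \<in> ideals N r \<Longrightarrow> T \<in> ideals N r \<Longrightarrow> S \<union> T \<in> ideals N r"
  by (auto simp: ideals_def)

lemma ideal_carrier: "N \<in> ideals N r"
  by (simp add: ideals_def)

lemma indep_empty: "{} \<in> F"
proof -
  obtain Y where "Y \<in> F" using matroid by (auto simp: poset_matroid_def)
  then show ?thesis using indep_subset ideal_empty by blast
qed

lemma finite_indep: "finite F"
  using finite_carrier indep_ideal ideal_subset by (meson PowI finite_Pow_iff finite_subset subsetI)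

lemma f_mono: "S \<in> ideals N r \<Longrightarrow> T \<in> ideals N r \<Longrightarrow> S \<subseteq> T \<Longrightarrow> f S \<le> f T"
  using mono by (simp add: mono_on_def)

lemma dr_gain:
  assumes "S \<in> ideals N r" "T \<in> ideals N r" "S \<subseteq> T" "(x, y) \<in> r" "x \<notin> S" "y \<notin> T"
    "insert x S \<in> ideals N r" "insert y T \<in> ideals N r"
  shows "f (insert y T) - f T \<le> f (insert x S) - f S"
  using dr assms unfolding dr_submodular_def by blast

lemma minimal_below:
  assumes "V \<in> ideals N r" "t \<in> N" "t \<notin> V"
  obtains m where "(m, t) \<in> r" "m \<in> N" "m \<notin> V" "insert m V \<in> ideals N r"
proof -
  let ?A = "{x \<in> N - V. (x, t) \<in> r}"
  let ?R = "\<lambda>x y. (x, y) \<in> r \<and> x \<noteq> y"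
  have "asymp_on ?A ?R" "transp_on ?A ?R"
    by (auto intro!: asymp_onI transp_onI dest: antisym_r trans_r)
  moreover have "finite ?A" "?A \<noteq> {}"
    using finite_carrier assms refl_r by auto
  ultimately obtain m where m: "m \<in> ?A" "\<forall>x\<in>?A. x \<noteq> m \<longrightarrow> \<not> ?R x m"
    using Finite_Set.bex_min_element[of ?A ?R] by blast
  then have "insert m V \<in> ideals N r"
    using assms(1) trans_r unfolding ideals_def by blast
  with m that show thesis by blast
qed

text \<open>Grow \<open>V\<close> to \<open>U\<close> by minimal missing elements. Each added
  \<open>m\<close> lies above some \<open>e\<close> that can be added to \<open>S\<close> with gain
  at most \<open>g\<close>, and DR-submodularity bounds the gain of \<open>m\<close> by that of
  \<open>e\<close>.\<close>

lemma ideal_gain_bound: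
  fixes g :: real
  assumes S: "S \<in> ideals N r" and "V \<in> ideals N r" "S \<subseteq> V" and U: "U \<in> ideals N r" and "V \<subseteq> U"
    and feas: "\<And>t. t \<in> U - V \<Longrightarrow> \<exists>e. (e, t) \<in> r \<and> e \<notin> S \<and> insert e S \<in> ideals N r \<and>
      f (insert e S) - f S \<le> g"
  shows "f U \<le> f V + card (U - V) * g"
  using assms(2,3,5) feas
proof (induction "card (U - V)" arbitrary: V)
  case 0
  then have "U = V" using U ideal_finite by auto
  then show ?case by simp
next
  case (Suc n)
  then have "U - V \<noteq> {}" by (metis card.empty nat.distinct(1))
  then obtain t where t: "t \<in> U" "t \<notin> V" by blast
  obtain m where m: "(m, t) \<in> r" "m \<in> N" "m \<notin> V" "insert m V \<in> ideals N r"
    using minimal_below Suc.prems(1) t U ideal_subset by blast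
  have "m \<in> U" using m t U by (auto simp: ideals_def)
  then obtain e where e: "(e, m) \<in> r" "e \<notin> S" "insert e S \<in> ideals N r"
      "f (insert e S) - f S \<le> g"
    using m Suc.prems(4)[of m] by blast
  have step: "f (insert m V) - f V \<le> g"
    using dr_gain[OF S Suc.prems(1,2) e(1,2) m(3) e(3) m(4)] e(4) by linarith
  have "card (U - insert m V) = n"
    using Suc.hyps(2) \<open>m \<in> U\<close> m(3) U ideal_finite
    by (metis Diff_insert DiffI card_Diff_singleton diff_Suc_1)
  then have "f U \<le> f (insert m V) + n * g"
    using Suc.hyps(1)[of "insert m V"] Suc.prems m \<open>m \<in> U\<close> by blast
  with step Suc.hyps(2)[symmetric] show ?case by (simp add: algebra_simps)
qed

section \<open>Greedy runs with the discarded elements forgotten\<close>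

inductive greedy_chain :: "'a set \<Rightarrow> bool" where
  empty: "greedy_chain {}"
| insert: "greedy_chain S \<Longrightarrow> x \<notin> S \<Longrightarrow> insert x S \<in> F \<Longrightarrow>
    (\<And>y. y \<notin> S \<Longrightarrow> insert y S \<in> F \<Longrightarrow> f (insert y S) \<le> f (insert x S)) \<Longrightarrow>
    greedy_chain (insert x S)"

lemma greedy_chain_indep: "greedy_chain S \<Longrightarrow> S \<in> F"
  by (induction rule: greedy_chain.induct) (auto simp: indep_empty)

text \<open>Rejection is permanent: unions of ideals are ideals, and an ideal containing a rejected
  one cannot be independent.\<close>

lemma reachable_chain:
  assumes "(greedy_step N r F f)\<^sup>*\<^sup>* ({}, {}) (S, Q)"
  shows "greedy_chain S \<and> S \<subseteq> Q \<and> (\<forall>q\<in>Q - S. insert q S \<in> ideals N r \<and> insert q S \<notin> F)"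
  using assms
proof (induction "(S, Q)" arbitrary: S Q rule: rtranclp_induct)
  case base
  then show ?case by (auto intro: greedy_chain.empty)
next
  case (step s)
  obtain S0 Q0 where s: "s = (S0, Q0)" by (cases s)
  have chain: "greedy_chain S0" and sub: "S0 \<subseteq> Q0"
    and disc: "\<And>q. q \<in> Q0 - S0 \<Longrightarrow> insert q S0 \<in> ideals N r \<and> insert q S0 \<notin> F"
    using step.hyps(3)[OF s] by auto
  from step.hyps(2)[unfolded s] obtain x where
    x: "is_arg_max (\<lambda>x. f (insert x S0) - f S0) (\<lambda>x. x \<in> greedy_candidates N r S0 Q0) x"
    and S: "S = (if insert x S0 \<in> F then insert x S0 else S0)" and Q: "Q = insert x Q0"
    unfolding greedy_step.simps prod.inject by blast
  have cand: "x \<in> N" "x \<notin> Q0" "insert x S0 \<in> ideals N r"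
    using x by (auto simp: is_arg_max_def greedy_candidates_def)
  show ?case
  proof (cases "insert x S0 \<in> F")
    case True
    \<comment> \<open>By the invariant a feasible \<open>y\<close> is still unprocessed, so it took
      part in the maximization.\<close>
    have "f (insert y S0) \<le> f (insert x S0)" if "y \<notin> S0" "insert y S0 \<in> F" for y
    proof -
      have "y \<in> greedy_candidates N r S0 Q0"
        using that disc indep_ideal[OF that(2)] ideal_subset
        by (auto simp: greedy_candidates_def)
      then show ?thesis using x by (auto simp: is_arg_max_def not_less)
    qed
    then have "greedy_chain (insert x S0)"
      using chain cand sub True by (blast intro: greedy_chain.insert)
    moreover have "insert q (insert x S0) \<in> ideals N r \<and> insert q (insert x S0) \<notin> F"
      if "q \<in> Q - S" for q
    proof -
      have q: "insert q S0 \<in> ideals N r" "insert q S0 \<notin> F"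
        using that disc S Q True by auto
      have "insert q (insert x S0) = insert q S0 \<union> insert x S0" by auto
      then show ?thesis
        using q ideal_Un[OF q(1) cand(3)] indep_subset[OF _ q(1)] by auto
    qed
    ultimately show ?thesis using S Q True sub by auto
  next
    case False
    then show ?thesis using S Q chain sub disc cand by auto
  qed
qed

lemma returns_chain:
  assumes "greedy_returns N r F f S"
  shows "greedy_chain S" and "y \<notin> S \<Longrightarrow> insert y S \<notin> F"
proof -
  obtain Q where Q: "(greedy_step N r F f)\<^sup>*\<^sup>* ({}, {}) (S, Q)" "greedy_candidates N r S Q = {}"
    using assms by (auto simp: greedy_returns_def)
  note chain = reachable_chain[OF Q(1)]
  show "greedy_chain S" using chain by blast
  show "insert y S \<notin> F" if "y \<notin> S"
  proof
    assume y: "insert y S \<in> F"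
    then have "y \<in> N" "insert y S \<in> ideals N r" using indep_ideal ideal_subset by blast+
    with Q(2) have "y \<in> Q" by (auto simp: greedy_candidates_def)
    with chain y that show False by blast
  qed
qed

section \<open>Blocked elements and the factor 1/2\<close>

definition blocked :: "'a set \<Rightarrow> 'a set \<Rightarrow> 'a set" where
  "blocked T S = {t \<in> T. \<forall>e. (e, t) \<in> r \<and> e \<notin> S \<longrightarrow> insert e S \<notin> F}"

text \<open>Being blocked passes to elements below \<open>t\<close> by transitivity, so the blocked
  part of \<open>T\<close> is a subideal.\<close>

lemma blocked_indep:
  assumes "T \<in> F" shows "blocked T S \<in> F"
proof (rule indep_subset[OF assms])
  show "blocked T S \<in> ideals N r"
    using indep_ideal[OF assms] unfolding ideals_def blocked_def by (auto dest: trans_r)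
qed (auto simp: blocked_def)

text \<open>Otherwise (M2) would add a blocked \<open>e\<close> to \<open>S\<close>, although
  \<open>e\<close> lies below itself.\<close>

lemma card_blocked_le:
  assumes "T \<in> F" "S \<in> F"
  shows "card (blocked T S) \<le> card S"
proof (rule ccontr)
  assume "\<not> ?thesis"
  then obtain e where "e \<in> blocked T S - S" "insert e S \<in> F"
    using indep_augment[OF assms(2) blocked_indep[OF assms(1)]] by force
  moreover have "(e, e) \<in> r"
    using indep_ideal[OF \<open>insert e S \<in> F\<close>] ideal_subset refl_r by blast
  ultimately show False by (auto simp: blocked_def)
qed

lemma ideal_insert_cases:
  assumes "S \<in> ideals N r" "insert y (insert x S) \<in> ideals N r"
  shows "insert y S \<in> ideals N r \<or> (x, y) \<in> r"
  using assms unfolding ideals_def by auto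

text \<open>If \<open>e\<close> below \<open>t\<close> becomes feasible only after adding
  \<open>x\<close>, then \<open>x\<close> lies below \<open>e\<close> and hence below
  \<open>t\<close>; but \<open>x\<close> was feasible for \<open>S\<close>, so \<open>t\<close> was
  not blocked.\<close>

lemma blocked_mono:
  assumes S: "S \<in> F" and "x \<notin> S" and xS: "insert x S \<in> F"
  shows "blocked T S \<subseteq> blocked T (insert x S)"
proof
  fix t assume t: "t \<in> blocked T S"
  have "insert e (insert x S) \<notin> F" if e: "(e, t) \<in> r" "e \<notin> insert x S" for e
  proof
    assume F: "insert e (insert x S) \<in> F"
    from ideal_insert_cases[OF indep_ideal[OF S] indep_ideal[OF F]] show False
    proof
      assume "insert e S \<in> ideals N r"
      then have "insert e S \<in> F" using indep_subset[OF F] by blast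
      with t e show False by (auto simp: blocked_def)
    next
      assume "(x, e) \<in> r"
      with e(1) have "(x, t) \<in> r" by (rule trans_r[rotated])
      with t xS \<open>x \<notin> S\<close> show False by (auto simp: blocked_def)
    qed
  qed
  with t show "t \<in> blocked T (insert x S)" by (auto simp: blocked_def)
qed

text \<open>The summation by parts: \<open>g\<close> is the last gain, and the surplus \<open>card S - card (blocked T S)\<close>
  pays for elements that become blocked later.\<close>

lemma greedy_chain_charge:
  assumes "greedy_chain S" and T: "T \<in> F"
  shows "\<exists>g\<ge>0. (\<forall>y. y \<notin> S \<longrightarrow> insert y S \<in> F \<longrightarrow> f (insert y S) - f S \<le> g) \<and>
    (\<forall>W\<in>ideals N r. S \<subseteq> W \<longrightarrow>
      f (W \<union> blocked T S) + (real (card S) - real (card (blocked T S))) * g \<le> f W + f S - f {})"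
  using assms(1)
proof induction
  case empty
  have "finite (blocked T {})" using blocked_indep[OF T] indep_ideal ideal_finite by blast
  then have B: "blocked T {} = {}" using card_blocked_le[OF T indep_empty] by simp
  \<comment> \<open>\<open>f N - f {}\<close> bounds every first gain; the surplus multiplying it is
    still zero.\<close>
  have "f (insert y {}) - f {} \<le> f N - f {}" if "insert y {} \<in> F" for y
    using f_mono[OF indep_ideal[OF that] ideal_carrier] indep_ideal[OF that] ideal_subset by auto
  moreover have "0 \<le> f N - f {}" using f_mono[OF ideal_empty ideal_carrier] by simp
  ultimately show ?case using B by (intro exI[of _ "f N - f {}"]) simp
next
  case (insert S x)
  let ?S = "insert x S" and ?B = "blocked T S" and ?B' = "blocked T (insert x S)"
  let ?d = "f ?S - f S"
  note SF = greedy_chain_indep[OF insert.hyps(1)]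
  have SI: "S \<in> ideals N r" and SI': "?S \<in> ideals N r"
    using SF insert.hyps(3) indep_ideal by blast+
  have BI: "?B \<in> ideals N r" "?B' \<in> ideals N r" using blocked_indep[OF T] indep_ideal by blast+
  obtain g where "g \<ge> 0" and g: "\<And>y. y \<notin> S \<Longrightarrow> insert y S \<in> F \<Longrightarrow> f (insert y S) - f S \<le> g"
    and W: "\<And>W. W \<in> ideals N r \<Longrightarrow> S \<subseteq> W \<Longrightarrow>
      f (W \<union> ?B) + (real (card S) - real (card ?B)) * g \<le> f W + f S - f {}"
    using insert.IH by blast
  have "?d \<le> g" using g insert.hyps by blast
  have "?d \<ge> 0" using f_mono[OF SI SI'] by auto
  have "f (insert y ?S) - f ?S \<le> ?d" if y: "y \<notin> ?S" "insert y ?S \<in> F" for y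
  proof -
    note yI = indep_ideal[OF y(2)]
    \<comment> \<open>Either \<open>y\<close> already competed with \<open>x\<close> at
      \<open>S\<close> and its gain has not grown since, or \<open>x\<close> lies below
      \<open>y\<close> and DR-submodularity compares the two directly.\<close>
    from ideal_insert_cases[OF SI yI] show ?thesis
    proof
      assume I: "insert y S \<in> ideals N r"
      then have "f (insert y S) \<le> f ?S"
        using insert.hyps(4) y indep_subset[OF y(2) I] by blast
      moreover have "(y, y) \<in> r" using yI ideal_subset refl_r by blast
      ultimately show ?thesis
        using dr_gain[OF SI SI' _ _ _ y(1) I yI] y by fastforce
    next
      assume "(x, y) \<in> r"
      then show ?thesis
        using dr_gain[OF SI SI' _ _ insert.hyps(2) y(1) SI' yI] by blast
    qed
  qed
  moreover have "f (W \<union> ?B') + (real (card ?S) - real (card ?B')) * ?d \<le> f W + f ?S - f {}"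
    if WI: "W \<in> ideals N r" and sub: "?S \<subseteq> W" for W
  proof -
    have mono: "?B \<subseteq> ?B'" using blocked_mono[OF SF insert.hyps(2,3)] .
    have fin: "finite ?B'" using BI ideal_finite by blast
    \<comment> \<open>Each newly blocked \<open>t\<close> still had a feasible element below it at
      \<open>S\<close>, whose gain is at most \<open>?d\<close>.\<close>
    have "f (W \<union> ?B') \<le> f (W \<union> ?B) + card ((W \<union> ?B') - (W \<union> ?B)) * ?d"
    proof (rule ideal_gain_bound[OF SI])
      fix t assume "t \<in> W \<union> ?B' - (W \<union> ?B)"
      then have "t \<in> T" "t \<notin> ?B" by (auto simp: blocked_def)
      then obtain e where e: "(e, t) \<in> r" "e \<notin> S" "insert e S \<in> F" by (auto simp: blocked_def)
      with insert.hyps(4)[of e] indep_ideal show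
        "\<exists>e. (e, t) \<in> r \<and> e \<notin> S \<and> insert e S \<in> ideals N r \<and> f (insert e S) - f S \<le> ?d"
        by auto
    qed (use WI sub BI mono ideal_Un in auto)
    also have "\<dots> \<le> f (W \<union> ?B) + card (?B' - ?B) * ?d"
      using \<open>?d \<ge> 0\<close> fin by (intro add_left_mono mult_right_mono of_nat_mono card_mono) auto
    also have "real (card (?B' - ?B)) = real (card ?B') - real (card ?B)"
      using mono fin by (simp add: card_Diff_subset card_mono finite_subset of_nat_diff)
    finally have 1: "f (W \<union> ?B') \<le> f (W \<union> ?B) + (real (card ?B') - real (card ?B)) * ?d" .
    \<comment> \<open>Lowering \<open>g\<close> to \<open>?d\<close> is sound because the surplus is
      nonnegative.\<close>
    have 2: "(real (card S) - real (card ?B)) * ?d \<le> (real (card S) - real (card ?B)) * g"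
      using \<open>?d \<le> g\<close> card_blocked_le[OF T SF] by (intro mult_left_mono) auto
    have 3: "f (W \<union> ?B) + (real (card S) - real (card ?B)) * g \<le> f W + f S - f {}"
      using W WI sub by blast
    have "real (card ?S) = real (card S) + 1"
      using insert.hyps(2) ideal_finite[OF SI] by simp
    \<comment> \<open>The additional \<open>?d\<close> is exactly the increase of \<open>f S\<close>
      on the right-hand side.\<close>
    then have "(real (card ?S) - real (card ?B')) * ?d =
        (real (card S) - real (card ?B)) * ?d - (real (card ?B') - real (card ?B)) * ?d + ?d"
      by (simp add: algebra_simps)
    with 1 2 3 show ?thesis by linarith
  qed
  ultimately show ?case using \<open>?d \<ge> 0\<close> by blast
qed

text \<open>At termination all of \<open>T\<close> is blocked; take \<open>W = S\<close> in the
  charging bound and drop the nonnegative surplus term.\<close>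

lemma greedy_half:
  assumes "greedy_returns N r F f S" and T: "T \<in> F"
  shows "f T \<le> 2 * f S"
proof -
  note chain = returns_chain[OF assms(1)]
  note SF = greedy_chain_indep[OF chain(1)]
  have "blocked T S = T" using chain(2) by (auto simp: blocked_def)
  then have card: "card T \<le> card S" using card_blocked_le[OF T SF] by simp
  obtain g where "g \<ge> 0" and
    g: "f (S \<union> T) + (real (card S) - real (card T)) * g \<le> f S + f S - f {}"
    using greedy_chain_charge[OF chain(1) T] indep_ideal[OF SF] \<open>blocked T S = T\<close>
    by (metis order_refl)
  have "(real (card S) - real (card T)) * g \<ge> 0" using \<open>g \<ge> 0\<close> card by simp
  moreover have "f T \<le> f (S \<union> T)"
    using f_mono[of T "S \<union> T"] ideal_Un indep_ideal SF T by blast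
  ultimately show ?thesis using g nonneg[OF ideal_empty] by linarith
qed

section \<open>Cardinality constraints\<close>

text \<open>The gap to \<open>f T\<close> after a step is at most \<open>1 - 1 / k\<close> times the
  gap before it, and \<open>1 - 1 / k \<le> exp (- 1 / k)\<close>.\<close>

lemma cardinality_chain_gap:
  assumes F: "F = {S \<in> ideals N r. card S \<le> k}" and "k > 0"
    and "greedy_chain S" and T: "T \<in> F"
  shows "f T - f S \<le> exp (- real (card S) / real k) * f T"
  using assms(3)
proof induction
  case empty
  then show ?case using nonneg[OF ideal_empty] by simp
next
  case (insert S x)
  let ?S = "insert x S"
  let ?d = "f ?S - f S"
  note SI = indep_ideal[OF greedy_chain_indep[OF insert.hyps(1)]]
  note TI = indep_ideal[OF T]
  have card: "card ?S = Suc (card S)" using insert.hyps(2) ideal_finite[OF SI] by simp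
  have SI': "?S \<in> ideals N r" and lt: "card S < k" using insert.hyps(3) card F by auto
  have "?d \<ge> 0" using f_mono[OF SI SI'] by auto
  have "f T \<le> f (S \<union> T)" using f_mono[OF TI ideal_Un[OF SI TI]] by auto
  also have "\<dots> \<le> f S + card (S \<union> T - S) * ?d"
  proof (rule ideal_gain_bound[OF SI SI _ ideal_Un[OF SI TI]])
    fix t assume "t \<in> S \<union> T - S"
    then have "t \<in> N" "t \<notin> S" using TI ideal_subset by blast+
    then obtain m where m: "(m, t) \<in> r" "m \<notin> S" "insert m S \<in> ideals N r"
      using minimal_below SI by metis
    \<comment> \<open>Below size \<open>k\<close> only the ideal property matters, so a minimal
      missing element is always feasible.\<close>
    then have "insert m S \<in> F" using lt F ideal_finite[OF SI] by simp
    with m insert.hyps(4)[of m] show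
      "\<exists>e. (e, t) \<in> r \<and> e \<notin> S \<and> insert e S \<in> ideals N r \<and> f (insert e S) - f S \<le> ?d"
      by auto
  qed auto
  also have "\<dots> \<le> f S + k * ?d"
  proof -
    have "card (S \<union> T - S) \<le> card T" using ideal_finite[OF TI] by (intro card_mono) auto
    also have "\<dots> \<le> k" using T F by simp
    finally show ?thesis using \<open>?d \<ge> 0\<close> by (simp add: mult_right_mono)
  qed
  finally have "(f T - f S) / k \<le> ?d" using \<open>k > 0\<close> by (simp add: field_simps)
  then have gap: "f T - f ?S \<le> (1 - 1 / k) * (f T - f S)"
    by (simp add: algebra_simps diff_divide_distrib)
  have "1 - 1 / k \<ge> 0" using \<open>k > 0\<close> by simp
  have "0 \<le> exp (- real (card S) / real k) * f T" using nonneg[OF TI] by simp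
  have "(1 - 1 / k) * (f T - f S) \<le> (1 - 1 / k) * (exp (- real (card S) / real k) * f T)"
    using insert.IH \<open>1 - 1 / k \<ge> 0\<close> by (rule mult_left_mono)
  also have "\<dots> \<le> exp (- 1 / real k) * (exp (- real (card S) / real k) * f T)"
    using exp_ge_add_one_self[of "- 1 / real k"] \<open>0 \<le> exp _ * f T\<close>
    by (intro mult_right_mono) auto
  also have "\<dots> = exp (- real (card ?S) / real k) * f T"
  proof -
    have "- real (card ?S) / real k = - 1 / real k + - real (card S) / real k"
      using \<open>k > 0\<close> by (simp add: card field_simps)
    then show ?thesis by (simp only: exp_add mult.assoc)
  qed
  finally show ?case using gap by linarith
qed

text \<open>An output with fewer than \<open>k\<close> elements must be all of \<open>N\<close>;
  otherwise it has exactly \<open>k\<close> elements and the gap bound has exponent -1.\<close>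

lemma greedy_cardinality:
  assumes F: "F = {S \<in> ideals N r. card S \<le> k}" and S: "greedy_returns N r F f S" and T: "T \<in> F"
  shows "(1 - 1 / exp 1) * f T \<le> f S"
proof (cases "card S < k")
  case True
  note chain = returns_chain[OF S]
  note SI = indep_ideal[OF greedy_chain_indep[OF chain(1)]] and TI = indep_ideal[OF T]
  have "S = N"
  proof (rule ccontr)
    assume "S \<noteq> N"
    then obtain t where "t \<in> N" "t \<notin> S" using ideal_subset[OF SI] by blast
    then obtain m where "m \<notin> S" "insert m S \<in> ideals N r"
      using minimal_below SI by metis
    with True F chain(2) ideal_finite[OF SI] show False by simp
  qed
  then have "f T \<le> f S" using f_mono[OF TI SI] ideal_subset[OF TI] by simp
  moreover have "(1 - 1 / exp 1) * f T \<le> 1 * f T"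
    using nonneg[OF TI] by (intro mult_right_mono) auto
  ultimately show ?thesis by simp
next
  case False
  note chain = returns_chain(1)[OF S]
  note SF = greedy_chain_indep[OF chain] and TI = indep_ideal[OF T]
  have card: "card S = k" using False SF F by simp
  show ?thesis
  \<comment> \<open>The exponent divides by \<open>k\<close>; for \<open>k = 0\<close> only the
    empty set is independent.\<close>
  proof (cases "k = 0")
    case True
    then have "S = {}" "T = {}"
      using F T SF ideal_finite[OF TI] ideal_finite[OF indep_ideal[OF SF]] by auto
    moreover have "(1 - 1 / exp 1) * f T \<le> 1 * f T"
      using nonneg[OF TI] by (intro mult_right_mono) auto
    ultimately show ?thesis by simp
  next
    case False
    then show ?thesis
      using cardinality_chain_gap[OF F _ chain T] card by (simp add: exp_minus field_simps)
  qed
qed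

section \<open>Termination and existence of an output\<close>

text \<open>The converse puts successors below predecessors; the number of unprocessed elements
  drops at each step.\<close>

lemma wfp_greedy_step: "wfp (greedy_step N r F f)\<inverse>\<inverse>"
proof (rule wfp_if_convertible_to_nat)
  fix s s' assume "(greedy_step N r F f)\<inverse>\<inverse> s s'"
  then obtain S Q x where "s' = (S, Q)" "snd s = insert x Q" "x \<in> N - Q"
    by (auto elim!: greedy_step.cases simp: is_arg_max_def greedy_candidates_def)
  then show "card (N - snd s) < card (N - snd s')"
    using finite_carrier by (intro psubset_card_mono) auto
qed

text \<open>A nonempty finite candidate set has a maximizer, so a run can always be continued until
  no candidate is left.\<close>

lemma greedy_returns_exists: "\<exists>S. greedy_returns N r F f S"
proof -
  have "\<exists>S Q. (greedy_step N r F f)\<^sup>*\<^sup>* s (S, Q) \<and> greedy_candidates N r S Q = {}" for s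
  proof (induction s rule: wfp_induct_rule[OF wfp_greedy_step])
    case (1 s)
    obtain S Q where s: "s = (S, Q)" by (cases s)
    let ?C = "greedy_candidates N r S Q"
    show ?case
    proof (cases "?C = {}")
      case False
      have "finite ?C" using finite_carrier by (simp add: greedy_candidates_def)
      let ?h = "\<lambda>x. f (insert x S) - f S"
      have "Max (?h ` ?C) \<in> ?h ` ?C" using \<open>finite ?C\<close> False by (intro Max_in) auto
      then obtain x where "x \<in> ?C" "?h x = Max (?h ` ?C)" by (metis (lifting) imageE)
      with \<open>finite ?C\<close> have "is_arg_max ?h (\<lambda>x. x \<in> ?C) x"
        by (simp add: is_arg_max_linorder)
      from greedy_step.intros[OF this] 1 s show ?thesis
        by (meson conversepI converse_rtranclp_into_rtranclp)
    qed (use s in blast)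
  qed
  then show ?thesis by (auto simp: greedy_returns_def)
qed

end

theorem theorem8:
  fixes N :: "'a set" and r :: "'a rel" and F :: "'a set set" and f :: "'a set \<Rightarrow> real"
  assumes "finite N" and "partial_order_on N r"
    and "poset_matroid N r F"
    and "\<And>S. S \<in> ideals N r \<Longrightarrow> 0 \<le> f S"
    and "mono_on (ideals N r) f"
    and "dr_submodular N r f"
  shows "wfp (greedy_step N r F f)\<inverse>\<inverse> \<and> (\<exists>S. greedy_returns N r F f S) \<and>
    (\<forall>S. greedy_returns N r F f S \<longrightarrow> S \<in> F \<and> f S \<ge> 1 / 2 * Max (f ` F)) \<and>
    (\<forall>k::nat. F = {S \<in> ideals N r. card S \<le> k} \<longrightarrow>
      (\<forall>S. greedy_returns N r F f S \<longrightarrow> f S \<ge> (1 - 1 / exp 1) * Max (f ` F)))"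
proof -
  interpret dr_poset_matroid N r F f
    using assms(3-6) by unfold_locales
  have "Max (f ` F) \<in> f ` F"
    using finite_indep indep_empty by (intro Max_in) auto
  then obtain T where T: "T \<in> F" "Max (f ` F) = f T" by auto
  have "S \<in> F \<and> f S \<ge> 1 / 2 * f T" if "greedy_returns N r F f S" for S
    using greedy_half[OF that T(1)] greedy_chain_indep returns_chain(1)[OF that] by simp
  moreover have "f S \<ge> (1 - 1 / exp 1) * f T"
    if "F = {S \<in> ideals N r. card S \<le> k}" "greedy_returns N r F f S" for k S
    using greedy_cardinality[OF that T(1)] .
  ultimately show ?thesis
    unfolding T(2) using wfp_greedy_step greedy_returns_exists by blast
qed

end
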